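(* A semigroup $S$ is right commutative and right cancellative if and only if it is an injective right regular extension of a commutative cancellative semigroup $T$. In this case, $S$ is idempotent-free if and only if $T$ is idempotent-free.
   Context: A semigroup is right commutative if it satisfies the identity $axy=ayx$. A semigroup is idempotent-free if it contains no element $e$ with $e^2=e$. Right regular extension: let $T$ be a left cancellative semigroup. To each $t\in T$ associate a nonempty set $S_t$ such that $S_t\cap S_r=\emptyset$ whenever $t\neq r$. For every pair $(t,r)\in T\times T$ with $r\in tT$, let $\varphi_{t,r}$ be a mapping of $S_t$ into $S_r$, written on the right of its argument, and assume that $\varphi_{t,r}\varphi_{r,q}=\varphi_{t,q}$ (first $\varphi_{t,r}$, then $\varphi_{r,q}$) for all $t\in T$, $r\in tT$, $q\in rT\subseteq tT$. On $S=\bigcup_{t\in T}S_t$ define $a*b=a\varphi_{t,tx}$ for $a\in S_t$, $b\in S_x$. Then $(S;* )$ is a semigroup, and a semigroup obtained in this way is called a right regular extension of the left cancellative semigroup $T$. It is called injective if all the mappings $\varphi_{t,r}$ ($t\in T$, $r\in tT$) are injective. *)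

theory Defs
  imports Main
begin

text \<open>
  A semigroup is an explicit carrier set with a binary operation whose values matter only on
  that set. The carrier is not required to be nonempty: an extension has an empty carrier
  exactly when its base has, so results for possibly empty semigroups specialise to the
  convention that semigroups are nonempty.
\<close>

definition semigroup_on :: "'a set \<Rightarrow> ('a \<Rightarrow> 'a \<Rightarrow> 'a) \<Rightarrow> bool" where
  "semigroup_on S f \<longleftrightarrow>
     (\<forall>x\<in>S. \<forall>y\<in>S. f x y \<in> S) \<and>
     (\<forall>x\<in>S. \<forall>y\<in>S. \<forall>z\<in>S. f (f x y) z = f x (f y z))"

definition commutative_on :: "'a set \<Rightarrow> ('a \<Rightarrow> 'a \<Rightarrow> 'a) \<Rightarrow> bool" where
  "commutative_on S f \<longleftrightarrow> (\<forall>x\<in>S. \<forall>y\<in>S. f x y = f y x)"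

definition right_commutative_on :: "'a set \<Rightarrow> ('a \<Rightarrow> 'a \<Rightarrow> 'a) \<Rightarrow> bool" where
  "right_commutative_on S f \<longleftrightarrow> (\<forall>a\<in>S. \<forall>x\<in>S. \<forall>y\<in>S. f (f a x) y = f (f a y) x)"

definition left_cancellative_on :: "'a set \<Rightarrow> ('a \<Rightarrow> 'a \<Rightarrow> 'a) \<Rightarrow> bool" where
  "left_cancellative_on S f \<longleftrightarrow> (\<forall>a\<in>S. \<forall>x\<in>S. \<forall>y\<in>S. f a x = f a y \<longrightarrow> x = y)"

definition right_cancellative_on :: "'a set \<Rightarrow> ('a \<Rightarrow> 'a \<Rightarrow> 'a) \<Rightarrow> bool" where
  "right_cancellative_on S f \<longleftrightarrow> (\<forall>a\<in>S. \<forall>x\<in>S. \<forall>y\<in>S. f x a = f y a \<longrightarrow> x = y)"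

definition cancellative_on :: "'a set \<Rightarrow> ('a \<Rightarrow> 'a \<Rightarrow> 'a) \<Rightarrow> bool" where
  "cancellative_on S f \<longleftrightarrow> left_cancellative_on S f \<and> right_cancellative_on S f"

definition idempotent_free_on :: "'a set \<Rightarrow> ('a \<Rightarrow> 'a \<Rightarrow> 'a) \<Rightarrow> bool" where
  "idempotent_free_on S f \<longleftrightarrow> \<not> (\<exists>e\<in>S. f e e = e)"

text \<open>
  The set \<open>tT\<close> is \<open>g t ` T\<close>. The map from \<open>A t\<close> to \<open>A r\<close> is \<open>\<phi> t r\<close>; since maps were
  originally written on the right, composing first \<open>\<phi> t r\<close> and then \<open>\<phi> r q\<close> gives
  \<open>\<phi> r q (\<phi> t r a)\<close>. Only the values of \<open>\<phi> t r\<close> on \<open>A t\<close> with \<open>t \<in> T\<close>, \<open>r \<in> tT\<close> matter.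
\<close>

definition right_regular_system ::
  "'b set \<Rightarrow> ('b \<Rightarrow> 'b \<Rightarrow> 'b) \<Rightarrow> ('b \<Rightarrow> 'a set) \<Rightarrow> ('b \<Rightarrow> 'b \<Rightarrow> 'a \<Rightarrow> 'a) \<Rightarrow> bool" where
  "right_regular_system T g A \<phi> \<longleftrightarrow>
     semigroup_on T g \<and> left_cancellative_on T g \<and>
     (\<forall>t\<in>T. A t \<noteq> {}) \<and>
     (\<forall>t\<in>T. \<forall>r\<in>T. t \<noteq> r \<longrightarrow> A t \<inter> A r = {}) \<and>
     (\<forall>t\<in>T. \<forall>r\<in>g t ` T. \<phi> t r ` A t \<subseteq> A r) \<and>
     (\<forall>t\<in>T. \<forall>r\<in>g t ` T. \<forall>q\<in>g r ` T. \<forall>a\<in>A t. \<phi> r q (\<phi> t r a) = \<phi> t q a)"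

definition right_regular_extension_by ::
  "'a set \<Rightarrow> ('a \<Rightarrow> 'a \<Rightarrow> 'a) \<Rightarrow> 'b set \<Rightarrow> ('b \<Rightarrow> 'b \<Rightarrow> 'b)
     \<Rightarrow> ('b \<Rightarrow> 'a set) \<Rightarrow> ('b \<Rightarrow> 'b \<Rightarrow> 'a \<Rightarrow> 'a) \<Rightarrow> bool" where
  "right_regular_extension_by S f T g A \<phi> \<longleftrightarrow>
     right_regular_system T g A \<phi> \<and>
     S = (\<Union>t\<in>T. A t) \<and>
     (\<forall>t\<in>T. \<forall>x\<in>T. \<forall>a\<in>A t. \<forall>b\<in>A x. f a b = \<phi> t (g t x) a)"

definition injective_right_regular_extension ::
  "'a set \<Rightarrow> ('a \<Rightarrow> 'a \<Rightarrow> 'a) \<Rightarrow> 'b set \<Rightarrow> ('b \<Rightarrow> 'b \<Rightarrow> 'b) \<Rightarrow> bool" where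
  "injective_right_regular_extension S f T g \<longleftrightarrow>
     (\<exists>A \<phi>. right_regular_extension_by S f T g A \<phi> \<and>
            (\<forall>t\<in>T. \<forall>r\<in>g t ` T. inj_on (\<phi> t r) (A t)))"

text \<open>
  HOL cannot quantify existentially over types. The blocks \<open>A t\<close> are nonempty, disjoint subsets
  of \<open>S\<close>, so a base of any type is isomorphic to one whose carrier lies in the type of \<open>S\<close>.
  Hence existence of a base is claimed inside that type \<open>'a\<close>, while anything assumed about a
  given base should be assumed for an arbitrary type \<open>'b\<close>.
\<close>

end

theory Submission
  imports Defs
begin

text \<open>
  The base of the extension consists of the right translations of \<open>S\<close>. If \<open>S\<close> is right
  commutative, they commute with each other, and if \<open>S\<close> is right cancellative, they are
  injective maps. A commutative semigroup of injective maps is cancellative: from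
  \<open>x a c = x b c\<close> for all \<open>x\<close> one gets \<open>x a = x b\<close> for all \<open>x\<close>. Sorting the elements of \<open>S\<close> by the
  translation that they induce gives the blocks \<open>A t\<close>. A product \<open>a b\<close> depends only on \<open>a\<close> and
  on the block of \<open>b\<close>, and the blocks of \<open>a\<close> and \<open>a b\<close> determine that of \<open>b\<close> by cancellation.
  So right multiplication yields the connecting maps, and they are injective by right
  cancellation (\<open>extension_of_representatives\<close>).

  Conversely, in an extension, \<open>a b c\<close> is the image of \<open>a\<close> under the connecting map into the
  block indexed by the product of the three indices, in which \<open>b\<close> and \<open>c\<close> may be exchanged when
  the base is commutative (\<open>right_commutative_extension\<close>). In an equation \<open>a c = b c\<close> the
  indices of \<open>a\<close> and \<open>b\<close> agree by cancellation in the base, and then \<open>a = b\<close> because the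
  connecting maps are injective (\<open>right_cancellative_extension\<close>).

  An idempotent of \<open>S\<close> has an idempotent index. If \<open>t\<close> is an idempotent index, then
  \<open>\<phi> t t\<close> is an idempotent injective map, hence the identity on \<open>A t\<close>, so every element of
  \<open>A t\<close> is idempotent (\<open>idempotent_free_extension_iff\<close>).
\<close>

section \<open>The semigroup of right translations\<close>

text \<open>
  A canonical element inducing the same right translation as \<open>a\<close>. Working with representatives
  rather than with the translations keeps the base inside the type of \<open>S\<close>.
\<close>

definition translation_rep :: "'a set \<Rightarrow> ('a \<Rightarrow> 'a \<Rightarrow> 'a) \<Rightarrow> 'a \<Rightarrow> 'a" where
  "translation_rep S f a = (SOME c. c \<in> S \<and> (\<forall>x\<in>S. f x c = f x a))"

lemma translation_rep:
  assumes "a \<in> S"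
  shows "translation_rep S f a \<in> S"
    and "x \<in> S \<Longrightarrow> f x (translation_rep S f a) = f x a"
proof -
  have "\<exists>c. c \<in> S \<and> (\<forall>x\<in>S. f x c = f x a)"
    using assms by blast
  from someI_ex[OF this]
  show "translation_rep S f a \<in> S" "x \<in> S \<Longrightarrow> f x (translation_rep S f a) = f x a"
    unfolding translation_rep_def by blast+
qed

lemma translation_rep_eq_iff:
  assumes "a \<in> S" "b \<in> S"
  shows "translation_rep S f a = translation_rep S f b \<longleftrightarrow> (\<forall>x\<in>S. f x a = f x b)"
proof
  assume "translation_rep S f a = translation_rep S f b"
  then show "\<forall>x\<in>S. f x a = f x b"
    using assms by (metis translation_rep(2))
next
  assume *: "\<forall>x\<in>S. f x a = f x b"
  have "(\<lambda>c. c \<in> S \<and> (\<forall>x\<in>S. f x c = f x a)) = (\<lambda>c. c \<in> S \<and> (\<forall>x\<in>S. f x c = f x b))"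
    using * by auto
  then show "translation_rep S f a = translation_rep S f b"
    unfolding translation_rep_def by simp
qed

text \<open>
  Inducing the same right translation is a congruence, because the translation of \<open>a b\<close> is the
  composite of those of \<open>a\<close> and \<open>b\<close>.
\<close>

lemma translation_rep_mult:
  assumes "semigroup_on S f" "a \<in> S" "b \<in> S"
  shows "translation_rep S f (f (translation_rep S f a) (translation_rep S f b))
         = translation_rep S f (f a b)"
proof -
  let ?r = "translation_rep S f"
  have closed: "f x y \<in> S" if "x \<in> S" "y \<in> S" for x y
    using assms(1) that by (auto simp: semigroup_on_def)
  have assoc: "f (f x y) z = f x (f y z)" if "x \<in> S" "y \<in> S" "z \<in> S" for x y z
    using assms(1) that by (auto simp: semigroup_on_def)
  have r: "?r a \<in> S" "?r b \<in> S"
    using assms by (simp_all add: translation_rep)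
  have "f x (f (?r a) (?r b)) = f x (f a b)" if "x \<in> S" for x
  proof -
    have "f x (f (?r a) (?r b)) = f (f x (?r a)) (?r b)"
      using assoc that r by simp
    also have "\<dots> = f (f x a) b"
      using assms that closed by (simp add: translation_rep)
    also have "\<dots> = f x (f a b)"
      using assoc that assms by simp
    finally show ?thesis .
  qed
  then show ?thesis
    using closed r assms by (simp add: translation_rep_eq_iff)
qed

lemma translation_rep_idem:
  "a \<in> S \<Longrightarrow> translation_rep S f (translation_rep S f a) = translation_rep S f a"
  by (simp add: translation_rep_eq_iff translation_rep)

text \<open>
  The product on representatives mirrors composition of right translations, so commutativity
  and right cancellation in \<open>T\<close> come down to identities \<open>f x a = f x b\<close> in \<open>S\<close>. The connecting
  map from \<open>A t\<close> to \<open>A r\<close> is right multiplication by the unique \<open>b \<in> T\<close> with \<open>g t b = r\<close>.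
\<close>

lemma extension_of_representatives:
  fixes S :: "'a set" and f :: "'a \<Rightarrow> 'a \<Rightarrow> 'a"
  assumes S: "semigroup_on S f" "right_commutative_on S f" "right_cancellative_on S f"
  defines "T \<equiv> translation_rep S f ` S"
    and "g \<equiv> \<lambda>u v. translation_rep S f (f u v)"
  shows "semigroup_on T g" "commutative_on T g" "cancellative_on T g"
    and "injective_right_regular_extension S f T g"
proof -
  let ?r = "translation_rep S f"
  have closed: "f x y \<in> S" if "x \<in> S" "y \<in> S" for x y
    using S that by (auto simp: semigroup_on_def)
  have assoc: "f (f x y) z = f x (f y z)" if "x \<in> S" "y \<in> S" "z \<in> S" for x y z
    using S that by (auto simp: semigroup_on_def)
  have rcomm: "f (f x y) z = f (f x z) y" if "x \<in> S" "y \<in> S" "z \<in> S" for x y z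
    using S that by (auto simp: right_commutative_on_def)
  have rcanc: "x = y" if "f x z = f y z" "x \<in> S" "y \<in> S" "z \<in> S" for x y z
    using S that by (auto simp: right_cancellative_on_def)
  have g: "g (?r a) (?r b) = ?r (f a b)" if "a \<in> S" "b \<in> S" for a b
    unfolding g_def using S that by (simp add: translation_rep_mult)
  have fixed: "?r t = t" "t \<in> S" if "t \<in> T" for t
    using that by (auto simp: T_def translation_rep_idem translation_rep)

  show semigroup: "semigroup_on T g"
    by (auto simp: semigroup_on_def T_def g closed assoc)
  show comm: "commutative_on T g"
  proof -
    have "f x (f a b) = f x (f b a)" if "x \<in> S" "a \<in> S" "b \<in> S" for x a b
      using rcomm[OF that] assoc that by simp
    then show ?thesis
      by (auto simp: commutative_on_def T_def g translation_rep_eq_iff closed)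
  qed
  have rcanc_T: "right_cancellative_on T g"
    unfolding right_cancellative_on_def
  proof (intro ballI impI)
    fix u s t assume "u \<in> T" "s \<in> T" "t \<in> T" and eq: "g s u = g t u"
    then obtain c a b where *: "u = ?r c" "s = ?r a" "t = ?r b" "c \<in> S" "a \<in> S" "b \<in> S"
      by (auto simp: T_def)
    have "f x a = f x b" if "x \<in> S" for x
    proof (rule rcanc[of _ c])
      show "f (f x a) c = f (f x b) c"
        using eq * that by (simp add: g translation_rep_eq_iff closed assoc)
    qed (use * that closed in auto)
    then show "s = t"
      using * by (simp add: translation_rep_eq_iff)
  qed
  show canc: "cancellative_on T g"
    using rcanc_T comm
    unfolding cancellative_on_def left_cancellative_on_def right_cancellative_on_def
      commutative_on_def by metis

  define A where "A t = {a \<in> S. ?r a = t}" for t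
  define \<phi> where "\<phi> t r a = f a (SOME b. b \<in> T \<and> g t b = r)" for t r a
  \<comment> \<open>Left cancellation makes the chosen factor unique.\<close>
  have \<phi>: "\<phi> t (g t x) a = f a x" if "t \<in> T" "x \<in> T" for t x a
  proof -
    have "(SOME b. b \<in> T \<and> g t b = g t x) = x"
      using that canc
      by (intro some_equality) (auto simp: cancellative_on_def left_cancellative_on_def)
    then show ?thesis
      by (simp add: \<phi>_def)
  qed
  have block_mult: "f a x \<in> A (g t x)" if "t \<in> T" "x \<in> T" "a \<in> A t" for t x a
    using that g[of a x] fixed[of x] by (auto simp: A_def closed)
  have T_mult: "g t x \<in> T" if "t \<in> T" "x \<in> T" for t x
    using semigroup that by (auto simp: semigroup_on_def)
  have trans: "f (f a x) y = f a (g x y)" if "a \<in> S" "x \<in> T" "y \<in> T" for a x y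
    unfolding g_def using that fixed[of x] fixed[of y]
    by (simp add: translation_rep closed assoc)

  have "right_regular_system T g A \<phi>"
    unfolding right_regular_system_def
  proof (intro conjI ballI impI)
    show "semigroup_on T g" "left_cancellative_on T g"
      using semigroup canc by (simp_all add: cancellative_on_def)
    show "A t \<noteq> {}" if "t \<in> T" for t
      using fixed[OF that] by (auto simp: A_def)
    show "A t \<inter> A r = {}" if "t \<noteq> r" for t r
      using that by (auto simp: A_def)
    show "\<phi> t r ` A t \<subseteq> A r" if "t \<in> T" "r \<in> g t ` T" for t r
      using that by (auto simp: \<phi> block_mult)
    show "\<phi> r q (\<phi> t r a) = \<phi> t q a"
      if t: "t \<in> T" and r: "r \<in> g t ` T" and q: "q \<in> g r ` T" and a: "a \<in> A t" for t r q a
    proof -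
      obtain x y where xy: "x \<in> T" "y \<in> T" "r = g t x" "q = g (g t x) y"
        using r q by auto
      have "q = g t (g x y)"
        using semigroup xy t by (auto simp: semigroup_on_def)
      then have "\<phi> t q a = f a (g x y)"
        using t xy T_mult by (simp add: \<phi>)
      moreover have "\<phi> r q (\<phi> t r a) = f (f a x) y"
        using t xy T_mult by (simp add: \<phi>)
      ultimately show ?thesis
        using trans a xy by (simp add: A_def)
    qed
  qed
  moreover have "S = (\<Union>t\<in>T. A t)"
    by (auto simp: A_def T_def)
  moreover have "f a b = \<phi> t (g t x) a" if "t \<in> T" "x \<in> T" "a \<in> A t" "b \<in> A x" for t x a b
    using that by (auto simp: \<phi> A_def translation_rep)
  moreover have "inj_on (\<phi> t r) (A t)" if "t \<in> T" "r \<in> g t ` T" for t r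
    using that by (auto simp: inj_on_def \<phi> A_def intro: rcanc fixed)
  ultimately show "injective_right_regular_extension S f T g"
    unfolding injective_right_regular_extension_def right_regular_extension_by_def by blast
qed

section \<open>Extensions of commutative cancellative semigroups\<close>

lemma right_regular_extension_byD:
  assumes "right_regular_extension_by S f T g A \<phi>"
  shows "a \<in> S \<Longrightarrow> \<exists>t\<in>T. a \<in> A t"
    and "t \<in> T \<Longrightarrow> a \<in> A t \<Longrightarrow> a \<in> S"
    and "t \<in> T \<Longrightarrow> x \<in> T \<Longrightarrow> g t x \<in> T"
    and "t \<in> T \<Longrightarrow> x \<in> T \<Longrightarrow> a \<in> A t \<Longrightarrow> b \<in> A x \<Longrightarrow> f a b = \<phi> t (g t x) a"
    and "t \<in> T \<Longrightarrow> x \<in> T \<Longrightarrow> a \<in> A t \<Longrightarrow> b \<in> A x \<Longrightarrow> f a b \<in> A (g t x)"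
    and "t \<in> T \<Longrightarrow> r \<in> T \<Longrightarrow> a \<in> A t \<Longrightarrow> a \<in> A r \<Longrightarrow> t = r"
    and "t \<in> T \<Longrightarrow> \<exists>a. a \<in> A t"
proof -
  have S: "S = (\<Union>t\<in>T. A t)"
    and nonempty: "\<forall>t\<in>T. A t \<noteq> {}"
    and disjoint: "\<forall>t\<in>T. \<forall>r\<in>T. t \<noteq> r \<longrightarrow> A t \<inter> A r = {}"
    and closed: "\<forall>t\<in>T. \<forall>x\<in>T. g t x \<in> T"
    and mult: "\<forall>t\<in>T. \<forall>x\<in>T. \<forall>a\<in>A t. \<forall>b\<in>A x. f a b = \<phi> t (g t x) a"
    and maps: "\<forall>t\<in>T. \<forall>r\<in>g t ` T. \<phi> t r ` A t \<subseteq> A r"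
    using assms
    unfolding right_regular_extension_by_def right_regular_system_def semigroup_on_def
    by simp_all
  show "a \<in> S \<Longrightarrow> \<exists>t\<in>T. a \<in> A t" and "t \<in> T \<Longrightarrow> a \<in> A t \<Longrightarrow> a \<in> S"
    using S by auto
  show "t \<in> T \<Longrightarrow> x \<in> T \<Longrightarrow> g t x \<in> T"
    using closed by simp
  show "t \<in> T \<Longrightarrow> x \<in> T \<Longrightarrow> a \<in> A t \<Longrightarrow> b \<in> A x \<Longrightarrow> f a b = \<phi> t (g t x) a"
    using mult by simp
  show "t \<in> T \<Longrightarrow> x \<in> T \<Longrightarrow> a \<in> A t \<Longrightarrow> b \<in> A x \<Longrightarrow> f a b \<in> A (g t x)"
    using mult maps by (simp add: image_subset_iff)
  show "t \<in> T \<Longrightarrow> r \<in> T \<Longrightarrow> a \<in> A t \<Longrightarrow> a \<in> A r \<Longrightarrow> t = r"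
    using disjoint by auto
  show "t \<in> T \<Longrightarrow> \<exists>a. a \<in> A t"
    using nonempty by auto
qed

text \<open>
  Since connecting maps compose, a triple product depends on its last two factors only through
  the product of their indices. Right commutativity of \<open>S\<close> thereby becomes a property of \<open>T\<close>,
  and taking all three factors in one block \<open>A t\<close> with \<open>t\<close> idempotent shows that \<open>\<phi> t t\<close> is
  idempotent.
\<close>

lemma right_regular_extension_by_mult3:
  assumes ext: "right_regular_extension_by S f T g A \<phi>"
    and T: "t \<in> T" "x \<in> T" "y \<in> T" and A: "a \<in> A t" "b \<in> A x" "c \<in> A y"
  shows "f (f a b) c = \<phi> t (g t (g x y)) a"
proof -
  note D = right_regular_extension_byD[OF ext]
  have "g (g t x) y = g t (g x y)"
    using ext T
    by (auto simp: right_regular_extension_by_def right_regular_system_def semigroup_on_def)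
  moreover have "f (f a b) c = \<phi> (g t x) (g (g t x) y) (\<phi> t (g t x) a)"
    using D T A by metis
  moreover have "\<phi> (g t x) (g (g t x) y) (\<phi> t (g t x) a) = \<phi> t (g (g t x) y) a"
    using ext T A unfolding right_regular_extension_by_def right_regular_system_def by blast
  ultimately show ?thesis
    by simp
qed

lemma right_commutative_extension:
  assumes ext: "right_regular_extension_by S f T g A \<phi>" and "commutative_on T g"
  shows "right_commutative_on S f"
  unfolding right_commutative_on_def
proof (intro ballI)
  fix a b c assume "a \<in> S" "b \<in> S" "c \<in> S"
  then obtain t x y where *: "t \<in> T" "x \<in> T" "y \<in> T" "a \<in> A t" "b \<in> A x" "c \<in> A y"
    by (auto dest!: right_regular_extension_byD(1)[OF ext])
  then have "g x y = g y x"
    using assms(2) by (auto simp: commutative_on_def)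
  with * show "f (f a b) c = f (f a c) b"
    using right_regular_extension_by_mult3[OF ext, of t x y a b c]
      right_regular_extension_by_mult3[OF ext, of t y x a c b] by simp
qed

lemma right_cancellative_extension:
  assumes ext: "right_regular_extension_by S f T g A \<phi>"
    and inj: "\<forall>t\<in>T. \<forall>r\<in>g t ` T. inj_on (\<phi> t r) (A t)"
    and canc: "right_cancellative_on T g"
  shows "right_cancellative_on S f"
  unfolding right_cancellative_on_def
proof (intro ballI impI)
  note D = right_regular_extension_byD[OF ext]
  fix c a b assume "c \<in> S" "a \<in> S" "b \<in> S" and eq: "f a c = f b c"
  then obtain u s t where *: "u \<in> T" "s \<in> T" "t \<in> T" "c \<in> A u" "a \<in> A s" "b \<in> A t"
    by (auto dest!: D(1))
  have "g s u = g t u"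
    using eq D(5)[of s u a c] D(5)[of t u b c] D(6)[of "g s u" "g t u" "f a c"] D(3) * by simp
  then have "s = t"
    using canc * unfolding right_cancellative_on_def by blast
  moreover have "\<phi> s (g s u) a = \<phi> t (g t u) b"
    using eq D(4)[of s u a c] D(4)[of t u b c] * by simp
  ultimately show "a = b"
    using inj * by (auto simp: inj_on_def)
qed

lemma idempotent_free_extension_iff:
  assumes ext: "right_regular_extension_by S f T g A \<phi>"
    and inj: "\<forall>t\<in>T. \<forall>r\<in>g t ` T. inj_on (\<phi> t r) (A t)"
  shows "idempotent_free_on S f \<longleftrightarrow> idempotent_free_on T g"
proof -
  note D = right_regular_extension_byD[OF ext]
  have "\<exists>t\<in>T. g t t = t" if e: "e \<in> S" "f e e = e" for e
  proof -
    obtain t where t: "t \<in> T" "e \<in> A t"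
      using D(1) e by blast
    then have "e \<in> A (g t t)"
      using D(5)[of t t e e] e by simp
    then show ?thesis
      using D(3,6) t by blast
  qed
  moreover have "\<exists>e\<in>S. f e e = e" if t: "t \<in> T" "g t t = t" for t
  proof -
    obtain e where e: "e \<in> A t"
      using D(7)[OF t(1)] ..
    have prod: "f e e = \<phi> t t e" and mem: "\<phi> t t e \<in> A t"
      using D(4,5)[of t t e e] t e by simp_all
    have t_mult: "t \<in> g t ` T"
      using t by (intro image_eqI[of t "g t" t]) simp_all
    \<comment> \<open>Both sides are the cube of \<open>e\<close>.\<close>
    have "\<phi> t t (\<phi> t t e) = \<phi> t t e"
      using right_regular_extension_by_mult3[OF ext, of t t t e e e]
        D(4)[of t t "\<phi> t t e" e] prod mem t e by simp
    moreover have "inj_on (\<phi> t t) (A t)"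
      using inj t(1) t_mult by blast
    ultimately have "\<phi> t t e = e"
      using e mem by (simp add: inj_on_eq_iff)
    then show ?thesis
      using prod D(2) t e by auto
  qed
  ultimately show ?thesis
    by (auto simp: idempotent_free_on_def)
qed

lemma injective_right_regular_extension_properties:
  assumes "commutative_on T g" "cancellative_on T g" "injective_right_regular_extension S f T g"
  shows "right_commutative_on S f" "right_cancellative_on S f"
    and "idempotent_free_on S f \<longleftrightarrow> idempotent_free_on T g"
proof -
  obtain A \<phi> where ext: "right_regular_extension_by S f T g A \<phi>"
    and inj: "\<forall>t\<in>T. \<forall>r\<in>g t ` T. inj_on (\<phi> t r) (A t)"
    using assms(3) unfolding injective_right_regular_extension_def by blast
  show "right_commutative_on S f"
    using ext assms(1) by (rule right_commutative_extension)
  show "right_cancellative_on S f"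
    using ext inj assms(2) unfolding cancellative_on_def
    by (blast intro: right_cancellative_extension)
  show "idempotent_free_on S f \<longleftrightarrow> idempotent_free_on T g"
    using ext inj by (rule idempotent_free_extension_iff)
qed

theorem theorem4:
  fixes S :: "'a set" and f :: "'a \<Rightarrow> 'a \<Rightarrow> 'a"
  assumes "semigroup_on S f"
  shows
    "(right_commutative_on S f \<and> right_cancellative_on S f \<longleftrightarrow>
       (\<exists>(T :: 'a set) g. semigroup_on T g \<and> commutative_on T g \<and> cancellative_on T g \<and>
          injective_right_regular_extension S f T g)) \<and>
     (\<forall>(T :: 'b set) g. semigroup_on T g \<and> commutative_on T g \<and> cancellative_on T g \<and>
          injective_right_regular_extension S f T g \<longrightarrow>
        right_commutative_on S f \<and> right_cancellative_on S f \<and>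
        (idempotent_free_on S f \<longleftrightarrow> idempotent_free_on T g))"
proof (rule conjI)
  show "right_commutative_on S f \<and> right_cancellative_on S f \<longleftrightarrow>
       (\<exists>(T :: 'a set) g. semigroup_on T g \<and> commutative_on T g \<and> cancellative_on T g \<and>
          injective_right_regular_extension S f T g)" (is "?rc \<longleftrightarrow> ?ext")
  proof
    assume ?rc
    then show ?ext
      using extension_of_representatives[OF assms] by blast
  next
    assume ?ext
    then obtain T :: "'a set" and g where "commutative_on T g" "cancellative_on T g"
      "injective_right_regular_extension S f T g"
      by (elim exE conjE)
    then show ?rc
      using injective_right_regular_extension_properties(1,2)[of T g S f] by simp
  qed
  show "\<forall>(T :: 'b set) g. semigroup_on T g \<and> commutative_on T g \<and> cancellative_on T g \<and>
          injective_right_regular_extension S f T g \<longrightarrow>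
        right_commutative_on S f \<and> right_cancellative_on S f \<and>
        (idempotent_free_on S f \<longleftrightarrow> idempotent_free_on T g)"
  proof (intro allI impI)
    fix T :: "'b set" and g
    assume "semigroup_on T g \<and> commutative_on T g \<and> cancellative_on T g \<and>
      injective_right_regular_extension S f T g"
    then show "right_commutative_on S f \<and> right_cancellative_on S f \<and>
        (idempotent_free_on S f \<longleftrightarrow> idempotent_free_on T g)"
      using injective_right_regular_extension_properties[of T g S f] by simp
  qed
qed

end
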